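(* Let $K \subset \mathbb{R}^d$ be compact and let $p \in [1,\infty]$. Suppose that for any $2d^2$ points in $K$ there is a line segment of $\ell_p$-length at least $1$ such that every point on the segment sees all $2d^2$ points. Then there is a line segment of $\ell_p$-length at least $d^{-1/p}$ such that every point on the segment sees all of $K$.
   Context: For $K \subset \mathbb{R}^d$ and $x,y \in K$, $x$ sees $y$ if the closed segment $[x,y]$ is contained in $K$. The $\ell_p$-length of a segment $[a,b]$ is $\|b-a\|_p$ (called its $\ell_p$-norm in the paper). *)

theory Defs
  imports "HOL-Analysis.Analysis"
begin

text \<open>Meant for \<open>1 \<le> p\<close>. On \<open>real ^ 'n\<close>, \<open>infnorm\<close> is the maximum of the absolute values of the
  coordinates; note \<open>0 powr r = 0\<close>, so vanishing coordinates contribute nothing.\<close>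

definition lp_norm :: "ereal \<Rightarrow> real ^ 'n \<Rightarrow> real" where
  "lp_norm p x =
    (if p = \<infinity> then infnorm x
     else (\<Sum>i\<in>UNIV. \<bar>x $ i\<bar> powr real_of_ereal p) powr (1 / real_of_ereal p))"

text \<open>Membership of \<open>x\<close> and \<open>y\<close> in \<open>K\<close> need not be required separately: both are endpoints of
  the segment.\<close>

definition sees :: "'a::real_vector set \<Rightarrow> 'a \<Rightarrow> 'a \<Rightarrow> bool" where
  "sees K x y \<longleftrightarrow> closed_segment x y \<subseteq> K"

end

theory Submission
  imports Defs
begin

text \<open>Put \<open>V\<^sub>x = {z. z sees x}\<close>. As in Krasnoselskii's theorem, the kernel of \<open>K\<close> is the intersection
  of the sets \<open>convex hull V\<^sub>x\<close>. Fix a coordinate \<open>i\<close> and a number \<open>c\<close>. The pairs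
  \<open>(a, b)\<close> with \<open>a, b \<in> convex hull V\<^sub>x\<close> and \<open>b\<^sub>i - a\<^sub>i = c\<close> form a convex set inside a hyperplane of
  dimension \<open>2d - 1\<close>, so Helly's theorem applies with Helly number \<open>2d\<close>. If no coordinate
  direction admitted such a pair for all \<open>x \<in> K\<close> at once, then collecting \<open>2d\<close> bad points for
  each of the \<open>d\<close> directions would give \<open>2d\<^sup>2\<close> points violating the hypothesis with \<open>c = d\<^sup>-\<^sup>1\<^sup>/\<^sup>p\<close>,
  since a vector of \<open>\<ell>\<^sub>p\<close>-norm at least 1 has a coordinate of absolute value at least \<open>c\<close>.\<close>

section \<open>Helly's theorem in an affine subspace\<close>

text \<open>Radon's argument by induction on the index set: affine dependence comes from the
  dimension of \<open>S\<close>, not of the whole space, so \<open>n + 1\<close> is the Helly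
  number. Indexing the sets lets them repeat.\<close>

lemma Helly_aff_dim_finite:
  fixes C :: "'i \<Rightarrow> 'a::euclidean_space set"
  assumes "finite I"
    and dim: "aff_dim S \<le> int n"
    and sub: "\<And>i. i \<in> I \<Longrightarrow> C i \<subseteq> S"
    and conv: "\<And>i. i \<in> I \<Longrightarrow> convex (C i)"
    and Int: "\<And>J. J \<subseteq> I \<Longrightarrow> card J \<le> n + 1 \<Longrightarrow> (\<Inter>j\<in>J. C j) \<noteq> {}"
  shows "(\<Inter>i\<in>I. C i) \<noteq> {}"
  using \<open>finite I\<close> sub conv Int
proof (induction I rule: finite_psubset_induct)
  case (psubset I)
  show ?case
  proof (cases "card I \<le> n + 1")
    case True
    then show ?thesis using psubset.prems(3) by blast
  next
    case False
    have "(\<Inter>j\<in>I - {i}. C j) \<noteq> {}" if "i \<in> I" for i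
    proof (rule psubset.IH)
      show "I - {i} \<subset> I" using that by blast
      show "(\<Inter>j\<in>J. C j) \<noteq> {}" if "J \<subseteq> I - {i}" "card J \<le> n + 1" for J
        using that by (intro psubset.prems(3)) auto
    qed (use psubset.prems(1,2) in auto)
    then have "\<forall>i\<in>I. \<exists>x. x \<in> (\<Inter>j\<in>I - {i}. C j)" by blast
    then obtain X where X: "\<And>i. i \<in> I \<Longrightarrow> X i \<in> (\<Inter>j\<in>I - {i}. C j)"
      by metis
    show ?thesis
    \<comment> \<open>Radon's theorem partitions the set of points and loses multiplicities. If two
      indices share a point, it already lies in every \<open>C k\<close>.\<close>
    proof (cases "inj_on X I")
      case False
      then obtain i j where ij: "i \<in> I" "j \<in> I" "i \<noteq> j" "X i = X j"
        by (auto simp: inj_on_def)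
      have "X i \<in> C k" if "k \<in> I" for k
        using X[OF ij(1)] X[OF ij(2)] ij that by (cases "k = i") auto
      then show ?thesis by blast
    next
      case True
      have "X i \<in> S" if "i \<in> I" for i
      proof -
        have "I - {i} \<noteq> {}"
        proof
          assume "I - {i} = {}"
          then have "card I \<le> card {i}" by (intro card_mono) auto
          with False show False by simp
        qed
        then show ?thesis using X[OF that] psubset.prems(1) by blast
      qed
      then have "X ` I \<subseteq> S" by blast
      moreover have "\<not> int (card (X ` I)) \<le> aff_dim S + 1"
        using card_image[OF True] False dim by simp
      ultimately have "affine_dependent (X ` I)"
        using independent_card_le_aff_dim by blast
      then obtain M P where MP: "M \<inter> P = {}" "M \<union> P = X ` I"
        and "convex hull M \<inter> convex hull P \<noteq> {}"
        using Radon_partition[of "X ` I"] psubset.hyps by blast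
      then obtain z where z: "z \<in> convex hull M" "z \<in> convex hull P" by blast
      \<comment> \<open>A Radon part avoiding \<open>X k\<close> consists of points chosen for other
        indices, all in the convex set \<open>C k\<close>. As \<open>M\<close> and \<open>P\<close>
        are disjoint, one of them avoids \<open>X k\<close>.\<close>
      have in_C: "z \<in> C k" if k: "k \<in> I" and Q: "z \<in> convex hull Q" "Q \<subseteq> X ` I" "X k \<notin> Q" for k Q
      proof -
        have "Q \<subseteq> C k" using X Q k by fastforce
        then have "convex hull Q \<subseteq> C k" using psubset.prems(2)[OF k] by (simp add: hull_minimal)
        then show ?thesis using Q by blast
      qed
      have "z \<in> C k" if "k \<in> I" for k
      proof (cases "X k \<in> M")
        case True
        then show ?thesis using in_C[OF that z(2)] MP by blast
      next
        case False
        then show ?thesis using in_C[OF that z(1)] MP by blast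
      qed
      then show ?thesis by blast
    qed
  qed
qed

lemma Helly_aff_dim_compact:
  fixes C :: "'i \<Rightarrow> 'a::euclidean_space set"
  assumes "aff_dim S \<le> int n"
    and "\<And>i. i \<in> I \<Longrightarrow> C i \<subseteq> S"
    and "\<And>i. i \<in> I \<Longrightarrow> convex (C i)"
    and "\<And>i. i \<in> I \<Longrightarrow> compact (C i)"
    and "\<And>J. finite J \<Longrightarrow> J \<subseteq> I \<Longrightarrow> card J \<le> n + 1 \<Longrightarrow> (\<Inter>j\<in>J. C j) \<noteq> {}"
  shows "(\<Inter>i\<in>I. C i) \<noteq> {}"
proof (rule compact_fip_Heine_Borel)
  fix F assume "finite F" "F \<subseteq> C ` I"
  then obtain J where J: "J \<subseteq> I" "finite J" "F = C ` J"
    by (meson finite_subset_image)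
  have "(\<Inter>j\<in>J. C j) \<noteq> {}"
  proof (rule Helly_aff_dim_finite[OF \<open>finite J\<close> assms(1)])
    fix L assume "L \<subseteq> J" "card L \<le> n + 1"
    then show "(\<Inter>j\<in>L. C j) \<noteq> {}"
      using J finite_subset[of L J] by (intro assms(5)) auto
  qed (use assms(2,3) J(1) in auto)
  then show "\<Inter>F \<noteq> {}" using J by simp
qed (use assms in auto)

section \<open>Visibility\<close>

lemma sees_iff: "sees K z x \<longleftrightarrow> (\<forall>t\<in>{0..1}. z + t *\<^sub>R (x - z) \<in> K)"
proof -
  have "z + t *\<^sub>R (x - z) = (1 - t) *\<^sub>R z + t *\<^sub>R x" for t
    by (simp add: algebra_simps)
  then show ?thesis by (auto simp: sees_def closed_segment_image_interval)
qed

lemma compact_sees: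
  fixes K :: "'a::euclidean_space set"
  assumes "compact K"
  shows "compact {z. sees K z x}"
proof -
  have "{z. sees K z x} = (\<Inter>t\<in>{0..1}. {z. z + t *\<^sub>R (x - z) \<in> K})"
    by (auto simp: sees_iff)
  moreover have "closed {z. z + t *\<^sub>R (x - z) \<in> K}" for t
  proof -
    have "continuous_on UNIV (\<lambda>z. z + t *\<^sub>R (x - z))" by (intro continuous_intros)
    then show ?thesis
      using closed_vimage[OF compact_imp_closed[OF assms]] by (simp add: vimage_def)
  qed
  ultimately have "closed {z. sees K z x}" by auto
  moreover have "bounded {z. sees K z x}"
    by (rule bounded_subset[OF compact_imp_bounded[OF assms]]) (auto simp: sees_def)
  ultimately show ?thesis by (simp add: compact_eq_bounded_closed)
qed

text \<open>Slide a ball missing \<open>K\<close> from a hidden point of the segment \<open>[z, y]\<close> towards \<open>y\<close> until it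
  first touches \<open>K\<close>, at \<open>x\<close> say. The tangent hyperplane at \<open>x\<close> separates \<open>z\<close> from all points that
  see \<open>x\<close>.\<close>

lemma sees_if_in_all_hulls:
  fixes K :: "'a::euclidean_space set"
  assumes "compact K"
    and z: "\<And>x. x \<in> K \<Longrightarrow> z \<in> convex hull {q. sees K q x}"
    and "y \<in> K"
  shows "sees K z y"
proof (rule ccontr)
  define w where "w t = z + t *\<^sub>R (y - z)" for t
  assume "\<not> sees K z y"
  then obtain t0 where t0: "0 \<le> t0" "t0 \<le> 1" "w t0 \<notin> K"
    by (auto simp: sees_iff w_def)
  have "closed K" "K \<noteq> {}" using assms compact_imp_closed by auto
  have cont: "continuous_on A (\<lambda>t. infdist (w t) K)" for A
    unfolding w_def by (intro continuous_intros)
  \<comment> \<open>Any radius strictly between 0 and the distance from \<open>w t0\<close> to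
    \<open>K\<close> would serve; the ball then starts off disjoint from \<open>K\<close>.\<close>
  define r where "r = infdist (w t0) K / 2"
  have pos: "infdist (w t0) K > 0"
    using t0 \<open>closed K\<close> \<open>K \<noteq> {}\<close> by (metis in_closed_iff_infdist_zero infdist_nonneg less_eq_real_def)
  have r: "r > 0" "r < infdist (w t0) K" using pos by (auto simp: r_def)
  define T where "T = {t \<in> {t0..1}. infdist (w t) K = r}"
  have ivt: "\<exists>t. t0 \<le> t \<and> t \<le> s \<and> infdist (w t) K = r" if "t0 \<le> s" "infdist (w s) K \<le> r" for s
    using IVT2'[of "\<lambda>t. infdist (w t) K" s r t0] that r cont by auto
  have "infdist (w 1) K = 0" using \<open>y \<in> K\<close> by (simp add: w_def)
  then have "T \<noteq> {}" using ivt[of 1] t0 r by (auto simp: T_def)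
  moreover have "compact T"
  proof -
    have "closed T" unfolding T_def
      using continuous_closed_preimage_constant[OF cont, of "{t0..1}" r] by simp
    moreover have "bounded T"
      by (rule bounded_subset[of "{t0..1}"]) (auto simp: T_def)
    ultimately show ?thesis by (simp add: compact_eq_bounded_closed)
  qed
  ultimately obtain t1 where t1: "t1 \<in> T" "\<And>t. t \<in> T \<Longrightarrow> t1 \<le> t"
    using compact_attains_inf by metis
  then have t1': "t0 \<le> t1" "t1 \<le> 1" "infdist (w t1) K = r" by (auto simp: T_def)
  have "t0 \<noteq> t1" using t1' r by auto
  obtain x where x: "x \<in> K" "dist (w t1) x = r"
    using infdist_attains_inf[OF \<open>closed K\<close> \<open>K \<noteq> {}\<close>] t1' by metis
  have near: "r \<le> dist (w t1) q" if "q \<in> K" for q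
    using infdist_le[OF that, of "w t1"] t1' by simp
  \<comment> \<open>The contact point is not behind the moving centre: otherwise stepping back from
    \<open>t1\<close> towards \<open>t0\<close> would approach \<open>x\<close>, and the
    intermediate value theorem would give a contact before \<open>t1\<close>.\<close>
  have "(y - z) \<bullet> (x - w t1) \<ge> 0"
  proof (rule ccontr)
    assume "\<not> ?thesis"
    moreover have "w t0 - w t1 = (t0 - t1) *\<^sub>R (y - z)" by (simp add: w_def scaleR_diff_left)
    ultimately have "(x - w t1) \<bullet> (w t0 - w t1) > 0"
      using t1' \<open>t0 \<noteq> t1\<close> by (simp add: mult_neg_neg inner_commute)
    then obtain u where u: "u > 0" "u \<le> 1" "dist (w t1 + u *\<^sub>R (w t0 - w t1)) x < dist (w t1) x"
      using closer_point_lemma by blast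
    define s where "s = t1 + u * (t0 - t1)"
    have ws: "w t1 + u *\<^sub>R (w t0 - w t1) = w s" by (simp add: w_def s_def algebra_simps)
    have "s < t1" using u t1' \<open>t0 \<noteq> t1\<close> by (simp add: s_def mult_pos_neg)
    have "(1 - u) * t0 \<le> (1 - u) * t1" using u t1' by (simp add: mult_left_mono)
    then have "t0 \<le> s" by (simp add: s_def algebra_simps)
    have "infdist (w s) K \<le> r"
      using infdist_le[OF x(1), of "w s"] u ws x(2) by simp
    then obtain t where "t0 \<le> t" "t \<le> s" "infdist (w t) K = r" using ivt \<open>t0 \<le> s\<close> by blast
    then have "t \<in> T" using \<open>s < t1\<close> t1' by (auto simp: T_def)
    then show False using t1(2) \<open>t \<le> s\<close> \<open>s < t1\<close> by fastforce
  qed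
  \<comment> \<open>Since \<open>z - w t1\<close> is \<open>- t1 *\<^sub>R (y - z)\<close>, this
    puts \<open>z\<close> beyond the tangent hyperplane at \<open>x\<close> by at least the square
    of \<open>r\<close>.\<close>
  then have "0 \<le> t1 * ((y - z) \<bullet> (x - w t1))" using t0 t1' by simp
  also have "\<dots> = (w t1 - x) \<bullet> z - (w t1 - x) \<bullet> x - (w t1 - x) \<bullet> (w t1 - x)"
  proof -
    have "z - x - (w t1 - x) = - t1 *\<^sub>R (y - z)" by (simp add: w_def)
    then have "(w t1 - x) \<bullet> (z - x - (w t1 - x)) = (w t1 - x) \<bullet> (- t1 *\<^sub>R (y - z))" by simp
    then show ?thesis by (simp add: inner_diff inner_commute algebra_simps)
  qed
  also have "(w t1 - x) \<bullet> (w t1 - x) = r\<^sup>2"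
    using x(2) power2_norm_eq_inner[of "w t1 - x"] by (simp add: dist_norm)
  finally have sep: "(w t1 - x) \<bullet> z > (w t1 - x) \<bullet> x" using r by (smt (verit) zero_less_power)
  \<comment> \<open>From a point \<open>q\<close> strictly on the centre's side, the segment
    \<open>[x, q]\<close> enters the open ball, which misses \<open>K\<close>.\<close>
  have "{q. sees K q x} \<subseteq> {q. (w t1 - x) \<bullet> q \<le> (w t1 - x) \<bullet> x}"
  proof (intro subsetI CollectI, rule ccontr)
    fix q assume q: "q \<in> {q. sees K q x}" "\<not> (w t1 - x) \<bullet> q \<le> (w t1 - x) \<bullet> x"
    then obtain u where u: "u > 0" "u \<le> 1" "dist (x + u *\<^sub>R (q - x)) (w t1) < dist x (w t1)"
      using closer_point_lemma[where x = x and y = "w t1" and z = q]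
      by (auto simp: inner_diff inner_commute)
    have "x + u *\<^sub>R (q - x) \<in> closed_segment x q"
      using u by (auto simp: closed_segment_def algebra_simps intro!: exI[of _ u])
    then have "x + u *\<^sub>R (q - x) \<in> K"
      using q closed_segment_commute[of x q] by (auto simp: sees_def)
    then show False using near u x(2) by (metis dist_commute not_le)
  qed
  then have "convex hull {q. sees K q x} \<subseteq> {q. (w t1 - x) \<bullet> q \<le> (w t1 - x) \<bullet> x}"
    by (intro hull_minimal convex_halfspace_le)
  then show False using z[OF x(1)] sep by auto
qed

section \<open>The norm and its coordinates\<close>

lemma component_le_lp_norm:
  assumes "1 \<le> p"
  shows "\<bar>x $ i\<bar> \<le> lp_norm p x"
proof (cases p)
  case (real q)
  then have q: "1 \<le> q" using assms by simp
  have "\<bar>x $ i\<bar> = (\<bar>x $ i\<bar> powr q) powr (1 / q)" using q by (simp add: powr_powr)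
  also have "\<dots> \<le> (\<Sum>i\<in>UNIV. \<bar>x $ i\<bar> powr q) powr (1 / q)"
    by (intro powr_mono2 member_le_sum) (use q in auto)
  finally show ?thesis using real by (simp add: lp_norm_def)
qed (use assms in \<open>auto simp: lp_norm_def component_le_infnorm_cart\<close>)

text \<open>Pigeonhole: among d summands with sum at least 1, one is at least 1/d. For infinite
  \<open>p\<close> the exponent \<open>1 / p\<close> is 0, so the bound reads 1 and a maximal
  coordinate attains it.\<close>

lemma large_component_if_lp_norm_ge_1:
  fixes x :: "real ^ 'n"
  assumes "1 \<le> p" "lp_norm p x \<ge> 1"
  shows "\<exists>i. real CARD('n) powr (- real_of_ereal (1 / p)) \<le> \<bar>x $ i\<bar>"
proof (cases p)
  case (real q)
  then have q: "1 \<le> q" using assms by simp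
  have inv: "real_of_ereal (1 / p) = 1 / q" using real q by (simp add: one_ereal_def)
  let ?S = "\<Sum>i\<in>UNIV. \<bar>x $ i\<bar> powr q"
  have "1 \<le> ?S powr (1 / q)" using assms(2) real by (simp add: lp_norm_def)
  then have "1 \<le> (?S powr (1 / q)) powr q" using q by (simp add: ge_one_powr_ge_zero)
  also have "\<dots> = ?S" using q by (simp add: powr_powr sum_nonneg)
  finally have S: "1 \<le> ?S" .
  have "\<exists>i. 1 / real CARD('n) \<le> \<bar>x $ i\<bar> powr q"
  proof (rule ccontr)
    assume "\<not> ?thesis"
    then have "?S < (\<Sum>i\<in>(UNIV :: 'n set). 1 / real CARD('n))"
      by (intro sum_strict_mono) (auto simp: not_le)
    then show False using S by simp
  qed
  then obtain i where "1 / real CARD('n) \<le> \<bar>x $ i\<bar> powr q" by blast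
  then have "(1 / real CARD('n)) powr (1 / q) \<le> (\<bar>x $ i\<bar> powr q) powr (1 / q)"
    using q by (intro powr_mono2) auto
  then show ?thesis
    using q inv by (intro exI[of _ i]) (simp add: powr_powr powr_minus powr_divide inverse_eq_divide)
next
  case PInf
  obtain i where "infnorm x = \<bar>x $ i\<bar>"
  proof -
    have "infnorm x \<in> (\<lambda>b. \<bar>x \<bullet> b\<bar>) ` Basis"
      unfolding infnorm_Max by (intro Max_in) auto
    then show ?thesis using that by (auto simp: Basis_vec_def inner_axis)
  qed
  then show ?thesis using assms PInf by (auto simp: lp_norm_def)
qed (use assms in auto)

section \<open>Pairs with prescribed coordinate difference\<close>

text \<open>A pair encodes the endpoints of a segment. Fixing one signed coordinate difference is a
  linear condition, so convexity survives, which a lower bound on the norm would not ensure.\<close>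

definition hull_pairs :: "(real ^ 'n) set \<Rightarrow> real \<Rightarrow> 'n \<Rightarrow> real ^ 'n \<Rightarrow> ((real ^ 'n) \<times> (real ^ 'n)) set" where
  "hull_pairs K c i x =
    ((convex hull {z. sees K z x}) \<times> (convex hull {z. sees K z x})) \<inter> {(a, b). b $ i - a $ i = c}"

lemma hull_pairs_Helly:
  fixes K :: "(real ^ 'n) set"
  assumes "compact K"
    and "\<And>J. finite J \<Longrightarrow> J \<subseteq> K \<Longrightarrow> card J \<le> 2 * CARD('n) \<Longrightarrow> (\<Inter>x\<in>J. hull_pairs K c i x) \<noteq> {}"
  shows "(\<Inter>x\<in>K. hull_pairs K c i x) \<noteq> {}"
proof -
  \<comment> \<open>Normal vector of the hyperplane that prescribes the difference; the hyperplane
    has dimension 2d - 1, whence Helly number 2d.\<close>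
  define e :: "(real ^ 'n) \<times> (real ^ 'n)" where "e = (- axis i 1, axis i 1)"
  let ?H = "{w. e \<bullet> w = c}"
  have H: "{(a, b). b $ i - a $ i = c} = ?H"
    by (auto simp: e_def inner_axis')
  have "e \<noteq> 0" by (simp add: e_def zero_prod_def)
  have "0 < CARD('n)" by simp
  show ?thesis
  proof (rule Helly_aff_dim_compact[where S = ?H and n = "2 * CARD('n) - 1"])
    show "aff_dim ?H \<le> int (2 * CARD('n) - 1)"
      using aff_dim_hyperplane[OF \<open>e \<noteq> 0\<close>, of c] \<open>0 < CARD('n)\<close> by simp
    show "hull_pairs K c i x \<subseteq> ?H" for x
      unfolding hull_pairs_def H by blast
    show "convex (hull_pairs K c i x)" for x
      unfolding hull_pairs_def H
      by (intro convex_Int convex_Times convex_convex_hull convex_hyperplane)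
    show "compact (hull_pairs K c i x)" for x
      unfolding hull_pairs_def H
      by (intro compact_Int_closed compact_Times compact_convex_hull compact_sees assms closed_hyperplane)
  qed (use assms in auto)
qed

text \<open>The hypothesis of the theorem speaks of sequences of fixed length, whereas Helly's
  theorem yields sets of bounded size; a fixed point of \<open>K\<close> pads the list.\<close>

lemma obtain_enumeration_with_repetition:
  assumes "finite U" "card U \<le> n" "U \<subseteq> K" "K \<noteq> {}"
  obtains v :: "nat \<Rightarrow> 'a" where "\<And>i. v i \<in> K" "U \<subseteq> v ` {..<n}"
proof -
  obtain k where "k \<in> K" using assms by blast
  obtain f where f: "bij_betw f {0..<card U} U" using ex_bij_betw_nat_finite[OF assms(1)] by blast
  define v where "v i = (if i < card U then f i else k)" for i
  have "v i \<in> K" for i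
    using f assms(3) \<open>k \<in> K\<close> by (auto simp: v_def bij_betw_def)
  moreover have "U \<subseteq> v ` {..<n}"
  proof
    fix u assume "u \<in> U"
    then obtain i where "i < card U" "u = f i" using bij_betw_imp_surj_on[OF f] by fastforce
    then show "u \<in> v ` {..<n}" using assms(2) by (auto simp: v_def intro!: image_eqI[of _ _ i])
  qed
  ultimately show ?thesis using that by blast
qed

lemma segment_with_coordinate_difference:
  fixes a b :: "real ^ 'n"
  assumes "0 < c" "c \<le> \<bar>(b - a) $ i\<bar>"
  obtains a' b' where "a' \<in> closed_segment a b" "b' \<in> closed_segment a b" "b' $ i - a' $ i = c"
proof -
  define t where "t = c / \<bar>(b - a) $ i\<bar>"
  have t: "0 \<le> t" "t \<le> 1" using assms by (auto simp: t_def)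
  define m where "m = a + t *\<^sub>R (b - a)"
  have m: "m \<in> closed_segment a b"
    using t by (auto simp: m_def closed_segment_def algebra_simps intro!: exI[of _ t])
  have mi: "m $ i - a $ i = t * (b - a) $ i" by (simp add: m_def)
  \<comment> \<open>The sign of the coordinate decides the order of the endpoints, so that the
    difference is \<open>c\<close> and not \<open>- c\<close>.\<close>
  show ?thesis
  proof (cases "(b - a) $ i > 0")
    case True
    then have "m $ i - a $ i = c" using mi assms by (simp add: t_def)
    then show ?thesis using that[of a m] m by simp
  next
    case False
    moreover from this have "(b - a) $ i < 0" using assms by auto
    ultimately have "m $ i - a $ i = - c" using mi by (simp add: t_def abs_of_neg del: vector_minus_component)
    then have "a $ i - m $ i = c" by simp
    then show ?thesis using that[of m a] m by simp
  qed
qed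

theorem theorem3p14:
  fixes K :: "(real ^ 'n) set" and p :: ereal
  assumes "compact K"
    and "1 \<le> p"
    and "\<And>v :: nat \<Rightarrow> real ^ 'n. (\<forall>i < 2 * CARD('n)\<^sup>2. v i \<in> K) \<Longrightarrow>
      \<exists>a b. lp_norm p (b - a) \<ge> 1 \<and>
        (\<forall>x \<in> closed_segment a b. \<forall>i < 2 * CARD('n)\<^sup>2. sees K x (v i))"
  shows "\<exists>a b. lp_norm p (b - a) \<ge> real CARD('n) powr (- real_of_ereal (1 / p)) \<and>
      (\<forall>x \<in> closed_segment a b. \<forall>y \<in> K. sees K x y)"
proof -
  define c where "c = real CARD('n) powr (- real_of_ereal (1 / p))"
  have "c > 0" by (simp add: c_def)
  have "\<exists>i. (\<Inter>x\<in>K. hull_pairs K c i x) \<noteq> {}"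
  proof (rule ccontr)
    assume none: "\<nexists>i. (\<Inter>x\<in>K. hull_pairs K c i x) \<noteq> {}"
    then have "K \<noteq> {}" by auto
    have "\<exists>J. finite J \<and> J \<subseteq> K \<and> card J \<le> 2 * CARD('n) \<and> (\<Inter>x\<in>J. hull_pairs K c i x) = {}" for i
    proof (rule ccontr)
      assume "\<not> ?thesis"
      then have "(\<Inter>x\<in>K. hull_pairs K c i x) \<noteq> {}"
        by (intro hull_pairs_Helly[OF assms(1)]) metis
      then show False using none by metis
    qed
    then obtain J where J: "\<And>i. finite (J i)" "\<And>i. J i \<subseteq> K" "\<And>i. card (J i) \<le> 2 * CARD('n)"
      "\<And>i. (\<Inter>x\<in>J i. hull_pairs K c i x) = {}" by metis
    \<comment> \<open>The bad sets for all directions are tested together, because the direction of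
      the segment is known only after the points are chosen.\<close>
    have "card (\<Union>i. J i) \<le> (\<Sum>i\<in>UNIV. card (J i))" by (rule card_UN_le) simp
    also have "\<dots> \<le> (\<Sum>i\<in>(UNIV :: 'n set). 2 * CARD('n))" by (intro sum_mono J)
    also have "\<dots> = 2 * CARD('n)\<^sup>2" by (simp add: power2_eq_square)
    finally have card: "card (\<Union>i. J i) \<le> 2 * CARD('n)\<^sup>2" .
    have "finite (\<Union>i. J i)" "(\<Union>i. J i) \<subseteq> K" using J(1,2) by auto
    then obtain v where v: "\<And>k. v k \<in> K" "(\<Union>i. J i) \<subseteq> v ` {..<2 * CARD('n)\<^sup>2}"
      using obtain_enumeration_with_repetition[OF _ card _ \<open>K \<noteq> {}\<close>] by metis
    then obtain a b where ab: "lp_norm p (b - a) \<ge> 1"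
      "\<And>x k. x \<in> closed_segment a b \<Longrightarrow> k < 2 * CARD('n)\<^sup>2 \<Longrightarrow> sees K x (v k)"
      using assms(3)[of v] by blast
    obtain i where "c \<le> \<bar>(b - a) $ i\<bar>"
      using large_component_if_lp_norm_ge_1[OF assms(2) ab(1)] by (auto simp: c_def)
    then obtain a' b' where a'b': "a' \<in> closed_segment a b" "b' \<in> closed_segment a b"
      "b' $ i - a' $ i = c"
      using segment_with_coordinate_difference[OF \<open>c > 0\<close>] by metis
    have "(a', b') \<in> hull_pairs K c i x" if "x \<in> J i" for x
    proof -
      have "x \<in> v ` {..<2 * CARD('n)\<^sup>2}" using that by (intro subsetD[OF v(2)]) auto
      then obtain k where "k < 2 * CARD('n)\<^sup>2" "x = v k" by auto
      then have "sees K a' x" "sees K b' x" using ab(2) a'b' by auto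
      then show ?thesis using a'b'(3) by (simp add: hull_pairs_def hull_inc)
    qed
    then have "(a', b') \<in> (\<Inter>x\<in>J i. hull_pairs K c i x)" by simp
    then show False using J(4)[of i] by simp
  qed
  then obtain i a b where ab: "\<And>x. x \<in> K \<Longrightarrow> (a, b) \<in> hull_pairs K c i x" by auto
  show ?thesis
  proof (cases "K = {}")
    case True
    \<comment> \<open>For empty \<open>K\<close> the pair \<open>(a, b)\<close> is unconstrained, so
      an explicit segment of sufficient length replaces it.\<close>
    have "c \<le> lp_norm p (axis i c - 0)"
      using component_le_lp_norm[OF assms(2), of "axis i c" i] by simp
    then show ?thesis using True unfolding c_def by blast
  next
    case False
    then have "b $ i - a $ i = c" using ab by (auto simp: hull_pairs_def)
    then have "c \<le> lp_norm p (b - a)"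
      using component_le_lp_norm[OF assms(2), of "b - a" i] by simp
    \<comment> \<open>Both endpoints lie in each convex hull, hence so does the whole
      segment.\<close>
    moreover have "sees K x y" if x: "x \<in> closed_segment a b" and "y \<in> K" for x y
    proof (rule sees_if_in_all_hulls[OF assms(1) _ \<open>y \<in> K\<close>])
      fix u assume "u \<in> K"
      then have "closed_segment a b \<subseteq> convex hull {q. sees K q u}"
        using ab by (intro closed_segment_subset convex_convex_hull) (auto simp: hull_pairs_def)
      then show "x \<in> convex hull {q. sees K q u}" using x by blast
    qed
    ultimately show ?thesis unfolding c_def by blast
  qed
qed

end
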